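(* A marker-per-face strategy with point-plane data does not uniquely determine a non-convex polyhedron: there exist two distinct non-convex polyhedra $P\neq Q$ in $\mathbb{R}^3$ and a finite set $M$ of point-plane markers that is a marker-per-face markup of both $P$ and $Q$. Moreover, the same holds for point-normal data: $M$ can be chosen as a set of point-normal markers that is a marker-per-face markup of both $P$ and $Q$.
   Context: A polyhedron is a closed, connected, three-dimensional region of $\mathbb{R}^3$ whose boundary consists of finitely many polygons (faces) such that every edge of every face is shared with exactly one other face, two faces intersect only in shared edges or vertices, and the faces sharing a vertex can be cyclically ordered so that consecutive faces share an edge. Faces are taken to be maximal: the closures of the connected components of the set of points of $\partial P$ having a neighbourhood in $\partial P$ contained in a single plane. A point-plane marker is a pair $(p,R)$ with $R$ a plane and $p\in R$; a finite set $M$ of such markers is a marker-per-face markup of $P$ if each $(p,R)\in M$ has $p$ on a face $F$ of $P$ with $R$ the plane of $F$, and every face $F$ contains the point of some marker whose plane is the plane of $F$. A point-normal marker is a pair $(p,n)$ with $p\in\mathbb{R}^3$ and $n$ a unit vector; a finite set of them is a marker-per-face markup of $P$ if each $(p,n)$ has $p$ on a face $F$ of $P$ with $n$ the outward unit normal of $P$ on $F$, and every face $F$ contains the point of some marker whose vector is the outward normal of $F$. *)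

theory Defs
  imports "HOL-Analysis.Analysis"
begin

type_synonym point = "real^3"

definition is_plane :: "point set \<Rightarrow> bool" where
  "is_plane R \<longleftrightarrow> (\<exists>a b. a \<noteq> 0 \<and> R = {x. a \<bullet> x = b})"

text \<open>Polygons of the boundary are represented by (non-degenerate) triangles, given by
  their vertex sets V (card V = 3, not collinear); the polygon is convex hull V.
  Every polygonal boundary in the sense of the paper can be triangulated so that
  the conditions below hold, and conversely such a triangulation is a valid
  polygonal boundary in the sense of the paper.\<close>
definition triangulated_boundary :: "point set \<Rightarrow> point set set \<Rightarrow> bool" where
  "triangulated_boundary P T \<longleftrightarrow>
     finite T \<and>
     (\<forall>V\<in>T. card V = 3 \<and> \<not> collinear V) \<and>
     frontier P = \<Union> ((\<lambda>V. convex hull V) ` T) \<and>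
     \<comment> \<open>two faces intersect only in a shared edge or vertex (or not at all)\<close>
     (\<forall>V\<in>T. \<forall>W\<in>T. V \<noteq> W \<longrightarrow> convex hull V \<inter> convex hull W = convex hull (V \<inter> W)) \<and>
     \<comment> \<open>every edge of every face is shared with exactly one other face\<close>
     (\<forall>V\<in>T. \<forall>e. e \<subseteq> V \<and> card e = 2 \<longrightarrow> card {W\<in>T. W \<noteq> V \<and> e \<subseteq> W} = 1) \<and>
     \<comment> \<open>faces at a vertex can be cyclically ordered, consecutive ones sharing an edge\<close>
     (\<forall>v \<in> \<Union>T. \<exists>xs. distinct xs \<and> set xs = {V\<in>T. v \<in> V} \<and>
         (\<forall>i<length xs. card (xs ! i \<inter> xs ! ((i + 1) mod length xs)) = 2))"

definition polyhedron :: "point set \<Rightarrow> bool" where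
  "polyhedron P \<longleftrightarrow> compact P \<and> connected P \<and> closure (interior P) = P \<and>
     (\<exists>T. triangulated_boundary P T)"

definition flat_part :: "point set \<Rightarrow> point set" where
  "flat_part P = {x \<in> frontier P. \<exists>e>0. \<exists>R. is_plane R \<and> frontier P \<inter> ball x e \<subseteq> R}"

definition faces :: "point set \<Rightarrow> point set set" where
  "faces P = closure ` components (flat_part P)"

definition plane_of_face :: "point set \<Rightarrow> point set \<Rightarrow> bool" where
  "plane_of_face F R \<longleftrightarrow> is_plane R \<and> F \<subseteq> R"

definition outward_normal :: "point set \<Rightarrow> point set \<Rightarrow> point \<Rightarrow> bool" where
  "outward_normal P F n \<longleftrightarrow> norm n = 1 \<and> (\<exists>c. F \<subseteq> {x. n \<bullet> x = c}) \<and>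
     (\<forall>x \<in> F \<inter> flat_part P. \<exists>e>0. \<forall>t. 0 < t \<and> t < e \<longrightarrow>
         x + t *\<^sub>R n \<notin> P \<and> x - t *\<^sub>R n \<in> P)"

definition point_plane_markup :: "(point \<times> point set) set \<Rightarrow> point set \<Rightarrow> bool" where
  "point_plane_markup M P \<longleftrightarrow> finite M \<and>
     (\<forall>(p, R)\<in>M. is_plane R \<and> p \<in> R \<and> (\<exists>F\<in>faces P. p \<in> F \<and> plane_of_face F R)) \<and>
     (\<forall>F\<in>faces P. \<exists>(p, R)\<in>M. p \<in> F \<and> plane_of_face F R)"

definition point_normal_markup :: "(point \<times> point) set \<Rightarrow> point set \<Rightarrow> bool" where
  "point_normal_markup M P \<longleftrightarrow> finite M \<and>
     (\<forall>(p, n)\<in>M. norm n = 1 \<and> (\<exists>F\<in>faces P. p \<in> F \<and> outward_normal P F n)) \<and>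
     (\<forall>F\<in>faces P. \<exists>(p, n)\<in>M. p \<in> F \<and> outward_normal P F n)"

end

(* In coordinates (x, y, z), the solid max (2|x| + |y|) (2|y| - |x|) + 2|z| <= 10 is a bipyramid
   over an octagon, star-shaped around 0, with apices (0, 0, +-5).  The vertices (+-5, 0) of the
   octagon are convex and (0, +-5) are reflex.  Swapping x and y gives an octagon in
   which these two kinds are interchanged, but which has the same pair of edge lines at each of
   the four points.  Hence the four oriented face planes through each of the four points are the same
   for the solid and its mirror image, and every face contains exactly one of these points. *)
theory Submission
  imports Defs
begin

section \<open>General facts: homogeneous sublevel sets, components, planes through hulls\<close>

lemma scaling_near_one_in_open:
  fixes x :: "'a::real_normed_vector"
  assumes "open S" "x \<in> S"
  obtains e where "0 < e" "e < 1" "(1 + e) *\<^sub>R x \<in> S" "(1 - e) *\<^sub>R x \<in> S"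
proof -
  have "open ((\<lambda>t::real. t *\<^sub>R x) -` S)"
    by (intro open_vimage assms continuous_intros)
  moreover have "1 \<in> (\<lambda>t::real. t *\<^sub>R x) -` S" using assms by simp
  ultimately obtain d where d: "d > 0" "ball 1 d \<subseteq> (\<lambda>t::real. t *\<^sub>R x) -` S"
    by (meson open_contains_ball)
  \<comment> \<open>Halving makes \<open>e\<close> strictly smaller than both \<open>d\<close> and
    1, so \<open>1 - e\<close> stays a positive factor.\<close>
  define e where "e = min d 1 / 2"
  have "e > 0" "e < 1" "e < d" using d by (auto simp: e_def)
  then have "1 + e \<in> ball 1 d" "1 - e \<in> ball 1 d" by (auto simp: dist_norm)
  with d \<open>e > 0\<close> \<open>e < 1\<close> show ?thesis using that[of e] by blast
qed

text \<open>With \<open>x\<close>, an open subset also contains a slightly longer multiple of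
  \<open>x\<close>; homogeneity and \<open>0 < r\<close> then make the inequality at
  \<open>x\<close> strict. The solid is not convex, so radial scaling takes the place of a convexity
  argument.\<close>

lemma interior_homogeneous_sublevel:
  fixes g :: "'a::real_normed_vector \<Rightarrow> real"
  assumes "continuous_on UNIV g" and hom: "\<And>c x. 0 \<le> c \<Longrightarrow> g (c *\<^sub>R x) = c * g x" and "0 < r"
  shows "interior {x. g x \<le> r} = {x. g x < r}"
proof (rule interior_unique)
  show "open {x. g x < r}"
    using assms(1) by (simp add: open_Collect_less)
  fix S assume S: "S \<subseteq> {x. g x \<le> r}" "open S"
  show "S \<subseteq> {x. g x < r}"
  proof
    fix x assume "x \<in> S"
    then obtain e where e: "0 < e" "(1 + e) *\<^sub>R x \<in> S"
      using scaling_near_one_in_open[OF S(2)] by metis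
    then have "(1 + e) * g x \<le> r" using S hom[of "1+e" x] by force
    also have "r < (1 + e) * r" using e \<open>0 < r\<close> by simp
    finally show "x \<in> {x. g x < r}" using e by simp
  qed
qed auto

text \<open>Dually, shrinking a point by the factor \<open>1 - e\<close> moves it strictly inside,
  so every neighbourhood of it meets the strict sublevel set.\<close>

lemma closure_homogeneous_sublevel:
  fixes g :: "'a::real_normed_vector \<Rightarrow> real"
  assumes "continuous_on UNIV g" and hom: "\<And>c x. 0 \<le> c \<Longrightarrow> g (c *\<^sub>R x) = c * g x" and "0 < r"
  shows "closure {x. g x < r} = {x. g x \<le> r}"
proof
  show "closure {x. g x < r} \<subseteq> {x. g x \<le> r}"
    using assms(1) by (intro closure_minimal) (auto intro!: closed_Collect_le)
  show "{x. g x \<le> r} \<subseteq> closure {x. g x < r}"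
  proof (rule ccontr)
    assume "\<not> ?thesis"
    then obtain x where x: "g x \<le> r" "x \<in> - closure {x. g x < r}" by auto
    then obtain e where e: "0 < e" "e < 1" "(1 - e) *\<^sub>R x \<in> - closure {x. g x < r}"
      using scaling_near_one_in_open[of "- closure {x. g x < r}" x] by auto
    have "(1 - e) * g x \<le> (1 - e) * r" using e x by (simp add: mult_left_mono)
    also have "\<dots> < r" using e \<open>0 < r\<close> by simp
    finally have "(1 - e) *\<^sub>R x \<in> {x. g x < r}" using hom[of "1-e" x] e by simp
    then show False using e closure_subset[of "{x. g x < r}"] by (meson ComplD subsetD)
  qed
qed

text \<open>The rest of \<open>S\<close> is the union of the other members, so each member is clopen
  in \<open>S\<close>; a connected set containing it cannot be larger.\<close>

lemma components_eqI:
  assumes "\<Union>\<O> = S" and op: "\<And>A. A \<in> \<O> \<Longrightarrow> openin (top_of_set S) A"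
    and con: "\<And>A. A \<in> \<O> \<Longrightarrow> connected A \<and> A \<noteq> {}"
    and dis: "pairwise disjnt \<O>"
  shows "components S = \<O>"
proof -
  have comp: "A \<in> components S" if "A \<in> \<O>" for A
  proof -
    have "S - A = \<Union>(\<O> - {A})"
      using assms(1) dis that by (auto simp: pairwise_def disjnt_def)
    then have "openin (top_of_set S) (S - A)" using op by (metis DiffD1 openin_Union)
    then have "closedin (top_of_set S) A"
      using op[OF that] by (simp add: closedin_def openin_imp_subset)
    moreover have "A \<subseteq> S" using assms(1) that by auto
    ultimately have "C = A" if C: "connected C" "C \<subseteq> S" "A \<subseteq> C" for C
    proof -
      have "openin (top_of_set C) A" "closedin (top_of_set C) A"
        using op[OF \<open>A \<in> \<O>\<close>] \<open>closedin (top_of_set S) A\<close> C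
        by (auto intro: openin_subset_trans closedin_subset_trans)
      then show ?thesis using C con[OF \<open>A \<in> \<O>\<close>] by (metis connected_clopen)
    qed
    then show ?thesis
      using con[OF that] \<open>A \<subseteq> S\<close> by (auto simp: in_components_maximal)
  qed
  moreover have "C \<in> \<O>" if "C \<in> components S" for C
  proof -
    obtain x where "x \<in> C" "x \<in> S"
      using in_components_nonempty[OF \<open>C \<in> components S\<close>] in_components_subset[OF \<open>C \<in> components S\<close>]
      by blast
    then obtain A where "A \<in> \<O>" "x \<in> A" using assms(1) by auto
    then show ?thesis using components_nonoverlap[OF that comp[of A]] \<open>x \<in> C\<close> by auto
  qed
  ultimately show ?thesis by blast
qed

text \<open>A short move from \<open>x\<close> towards the vertex \<open>v\<close> stays in the
  ball. The functional takes the value \<open>b\<close> at both ends of that move, hence at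
  \<open>v\<close> too. So a plane that contains the boundary near a point contains every triangle
  through that point.\<close>

lemma hull_subset_plane:
  fixes a :: "'a::real_inner"
  assumes V: "finite V" and x: "x \<in> convex hull V" and e: "0 < e"
    and sub: "convex hull V \<inter> ball x e \<subseteq> {y. a \<bullet> y = b}" and v: "v \<in> V"
  shows "a \<bullet> v = b"
proof -
  \<comment> \<open>The move has length at most \<open>e / 2\<close>; the summand \<open>e\<close>
    in the denominator also covers \<open>v = x\<close>.\<close>
  define t where "t = e / (2 * (norm (v - x) + e))"
  have pos: "norm (v - x) + e > 0" using e by (simp add: add_nonneg_pos)
  have t: "0 < t" "t \<le> 1" using e pos by (auto simp: t_def field_simps)
  define y where "y = (1 - t) *\<^sub>R x + t *\<^sub>R v"
  have "y \<in> convex hull V"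
    unfolding y_def using t x hull_inc[OF v, of convex] convex_convex_hull
    by (intro convexD_alt) auto
  moreover have "y - x = t *\<^sub>R (v - x)" by (simp add: y_def algebra_simps)
  then have "dist x y = t * norm (v - x)" using t by (metis abs_of_pos dist_commute dist_norm norm_scaleR)
  moreover have "t * norm (v - x) < e"
  proof -
    have "t * norm (v - x) \<le> t * (norm (v - x) + e)" using t e by simp
    also have "\<dots> = e / 2" using pos by (simp add: t_def add_pos_nonneg divide_simps)
    finally show ?thesis using e by simp
  qed
  ultimately have "a \<bullet> y = b" "a \<bullet> x = b" using sub x e by auto
  then have "t * (a \<bullet> v) = t * b" by (simp add: y_def inner_add_right algebra_simps)
  then show ?thesis using t by simp
qed

section \<open>Labels, coordinates, vertices and the solid\<close>

text \<open>\<open>X\<close>, \<open>Y\<close> and \<open>Z\<close> label the vertices on the three coordinate axes, \<open>U\<close> the remaining four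
  vertices of the octagon; the Booleans are the signs of the coordinates.  A face is
  given by its octant and by whether it ends at an \<open>X\<close> or at a \<open>Y\<close> vertex.\<close>

datatype label = X bool | Y bool | U bool bool | Z bool

abbreviation sg :: "bool \<Rightarrow> real" where "sg b \<equiv> if b then 1 else -1"

fun face :: "bool \<times> bool \<times> bool \<times> bool \<Rightarrow> label set" where
  "face (t, a, b, c) = {if t then X a else Y b, U a b, Z c}"

text \<open>The axes are parameters so that the mirror image is the same construction with
  \<open>i\<close> and \<open>j\<close> exchanged; each fact below then serves both solids.\<close>

locale axes =
  fixes i j k :: 3
  assumes distinct_axes: "i \<noteq> j" "i \<noteq> k" "j \<noteq> k"
begin

lemma UNIV_axes: "UNIV = {i, j, k}"
proof -
  have "card {i, j, k} = CARD(3)" using distinct_axes by simp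
  then show ?thesis by (metis card_subset_eq finite subset_UNIV)
qed

definition vec3 :: "real \<Rightarrow> real \<Rightarrow> real \<Rightarrow> point" where
  "vec3 p q r = (\<chi> l. if l = i then p else if l = j then q else r)"

lemma vec3_nth [simp]: "vec3 p q r $ i = p" "vec3 p q r $ j = q" "vec3 p q r $ k = r"
  using distinct_axes by (auto simp: vec3_def)

lemma point_eq_iff: "x = y \<longleftrightarrow> x $ i = y $ i \<and> x $ j = y $ j \<and> x $ k = (y::point) $ k"
  using UNIV_axes by (metis (full_types) UNIV_I empty_iff insert_iff vec_eq_iff)

lemma inner_axes: "x \<bullet> y = x $ i * y $ i + x $ j * y $ j + x $ k * (y::point) $ k"
  using distinct_axes unfolding inner_vec_def UNIV_axes by simp

fun pos :: "label \<Rightarrow> point" where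
  "pos (X s) = vec3 (5 * sg s) 0 0"
| "pos (Y s) = vec3 0 (5 * sg s) 0"
| "pos (U s s') = vec3 (2 * sg s) (6 * sg s') 0"
| "pos (Z s) = vec3 0 0 (5 * sg s)"

lemma inj_pos: "inj pos"
proof (rule injI)
  fix l m assume "pos l = pos m"
  then show "l = m"
    by (cases l; cases m) (auto simp: point_eq_iff split: if_splits)
qed

text \<open>Scaled so that each face plane is \<open>normal f \<bullet> x = 10\<close>; all these
  vectors have length 3, so the unit normals are rational.\<close>

fun normal :: "bool \<times> bool \<times> bool \<times> bool \<Rightarrow> point" where
  "normal (t, a, b, c) = (if t then vec3 (2 * sg a) (sg b) (2 * sg c) else vec3 (- sg a) (2 * sg b) (2 * sg c))"

definition tri :: "bool \<times> bool \<times> bool \<times> bool \<Rightarrow> point set" where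
  "tri f = convex hull (pos ` face f)"

text \<open>Ten times the Minkowski gauge of \<open>solid\<close>. The two branches of
  \<open>max\<close> agree where the \<open>j\<close> coordinate is three times the \<open>i\<close>
  coordinate in absolute value, that is, over the rays through the \<open>U\<close>
  vertices.\<close>

definition gauge :: "point \<Rightarrow> real" where
  "gauge x = max (2 * \<bar>x $ i\<bar> + \<bar>x $ j\<bar>) (2 * \<bar>x $ j\<bar> - \<bar>x $ i\<bar>) + 2 * \<bar>x $ k\<bar>"

definition solid :: "point set" where
  "solid = {x. gauge x \<le> 10}"

text \<open>Barycentric coordinates, given on the whole boundary at once: a hat function
  vanishes on the faces that do not contain its vertex, so that two faces meet only in
  the hull of their common vertices.\<close>

fun hat :: "label \<Rightarrow> point \<Rightarrow> real" where
  "hat (X s) x = max 0 (3 * (sg s * x $ i) - \<bar>x $ j\<bar>) / 15"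
| "hat (Y s) x = max 0 (sg s * x $ j - 3 * \<bar>x $ i\<bar>) / 5"
| "hat (U s s') x = max 0 (min (sg s * x $ i / 2) (sg s' * x $ j / 6))"
| "hat (Z s) x = max 0 (sg s * x $ k) / 5"

text \<open>The sixteen cones from the origin over the faces. They cover space, and
  \<open>gauge\<close> and all hat functions are linear on each; the factor \<open>sg t\<close>
  selects the side of the plane through the \<open>U\<close> ray.\<close>

fun closed_cell :: "bool \<times> bool \<times> bool \<times> bool \<Rightarrow> point set" where
  "closed_cell (t, a, b, c) = {x. 0 \<le> sg a * x $ i \<and> 0 \<le> sg b * x $ j \<and> 0 \<le> sg c * x $ k \<and>
     0 \<le> sg t * (3 * (sg a * x $ i) - sg b * x $ j)}"

fun cell :: "bool \<times> bool \<times> bool \<times> bool \<Rightarrow> point set" where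
  "cell (t, a, b, c) = {x. 0 < sg a * x $ i \<and> 0 < sg b * x $ j \<and> 0 < sg c * x $ k \<and>
     0 < sg t * (3 * (sg a * x $ i) - sg b * x $ j)}"

section \<open>Barycentric coordinates on the cones\<close>

lemma hat_nonneg: "0 \<le> hat l x"
  by (cases l) auto

lemma abs_closed_cell:
  assumes "x \<in> closed_cell (t, a, b, c)"
  shows "\<bar>x $ i\<bar> = sg a * x $ i" "\<bar>x $ j\<bar> = sg b * x $ j" "\<bar>x $ k\<bar> = sg c * x $ k"
  using assms by (auto simp: abs_if)

lemma hat_closed_cell:
  assumes "x \<in> closed_cell (t, a, b, c)"
  shows "hat (X a) x = (if t then (3 * (sg a * x $ i) - sg b * x $ j) / 15 else 0)"
    and "hat (Y b) x = (if t then 0 else (sg b * x $ j - 3 * (sg a * x $ i)) / 5)"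
    and "hat (U a b) x = (if t then sg b * x $ j / 6 else sg a * x $ i / 2)"
    and "hat (Z c) x = sg c * x $ k / 5"
    and "hat (X (\<not> a)) x = 0" "hat (Y (\<not> b)) x = 0" "hat (Z (\<not> c)) x = 0"
    and "hat (U a (\<not> b)) x = 0" "hat (U (\<not> a) b) x = 0" "hat (U (\<not> a) (\<not> b)) x = 0"
  using assms unfolding hat.simps abs_closed_cell[OF assms]
  by (cases t; cases a; cases b; cases c;
      simp add: max_absorb1 max_absorb2 min_absorb1 min_absorb2)+

text \<open>Inside a cone only the hats of its three vertices survive, and they add up to
  \<open>normal f \<bullet> x / 10\<close>, which is 1 on the face plane.\<close>

lemma hat_sum:
  assumes "x \<in> closed_cell f" "normal f \<bullet> x = 10"
  shows "(\<Sum>l\<in>face f. hat l x) = 1" "(\<Sum>l\<in>face f. hat l x *\<^sub>R pos l) = x"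
    and "\<And>l. l \<notin> face f \<Longrightarrow> hat l x = 0"
proof -
  obtain t a b c where f: "f = (t, a, b, c)" by (metis prod_cases4)
  note hat = hat_closed_cell[OF assms(1)[unfolded f]]
  show "(\<Sum>l\<in>face f. hat l x) = 1"
    using assms(2) unfolding f
    by (cases t) (simp_all del: hat.simps add: hat inner_axes field_simps)
  show "(\<Sum>l\<in>face f. hat l x *\<^sub>R pos l) = x"
    using assms(2) unfolding f
    by (cases t) (simp_all del: hat.simps add: hat inner_axes point_eq_iff field_simps)
  show "hat l x = 0" if "l \<notin> face f" for l
  proof -
    have "l \<in> {X a, X (\<not> a), Y b, Y (\<not> b), Z c, Z (\<not> c), U a b, U a (\<not> b), U (\<not> a) b, U (\<not> a) (\<not> b)}"
      by (cases l) auto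
    then show ?thesis
      using that unfolding f
      by (elim insertE emptyE) (simp_all del: hat.simps add: hat split: if_splits)
  qed
qed

lemma gauge_closed_cell:
  assumes "x \<in> closed_cell f"
  shows "gauge x = normal f \<bullet> x"
proof -
  obtain t a b c where f: "f = (t, a, b, c)" by (metis prod_cases4)
  show ?thesis
    using assms unfolding f gauge_def abs_closed_cell[OF assms[unfolded f]]
    by (cases t; cases a; cases b) (simp_all add: inner_axes)
qed

section \<open>Cells as intersections of half-spaces, and triangles as plane sections\<close>

lemmas simps_by_index = closed_cell.simps cell.simps face.simps normal.simps

declare simps_by_index [simp del]

text \<open>In this form convexity and invariance under nonnegative scaling follow one half-space at
  a time.\<close>

lemma closed_cell_halfspaces:
  "closed_cell (t, a, b, c) = {x. vec3 (sg a) 0 0 \<bullet> x \<ge> 0} \<inter> {x. vec3 0 (sg b) 0 \<bullet> x \<ge> 0}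
    \<inter> {x. vec3 0 0 (sg c) \<bullet> x \<ge> 0} \<inter> {x. vec3 (sg t * 3 * sg a) (- sg t * sg b) 0 \<bullet> x \<ge> 0}"
  by (auto simp: simps_by_index inner_axes)

lemma cell_halfspaces:
  "cell (t, a, b, c) = {x. vec3 (sg a) 0 0 \<bullet> x > 0} \<inter> {x. vec3 0 (sg b) 0 \<bullet> x > 0}
    \<inter> {x. vec3 0 0 (sg c) \<bullet> x > 0} \<inter> {x. vec3 (sg t * 3 * sg a) (- sg t * sg b) 0 \<bullet> x > 0}"
  by (auto simp: simps_by_index inner_axes)

lemma convex_closed_cell: "convex (closed_cell f)"
  by (cases f rule: prod_cases4)
    (simp only: closed_cell_halfspaces convex_Int convex_halfspace_ge)

lemma convex_cell: "convex (cell f)"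
  by (cases f rule: prod_cases4) (simp only: cell_halfspaces convex_Int convex_halfspace_gt)

lemma open_cell: "open (cell f)"
  by (cases f rule: prod_cases4) (simp only: cell_halfspaces open_Int open_halfspace_gt)

lemma cell_subset_closed_cell: "cell f \<subseteq> closed_cell f"
  by (cases f rule: prod_cases4) (auto simp: simps_by_index)

text \<open>In each defining inequality \<open>x\<close> contributes a nonnegative and
  \<open>y\<close> a positive amount, so strictness survives for every \<open>u > 0\<close>.\<close>

lemma cell_convex_combination:
  assumes x: "x \<in> closed_cell f" and y: "y \<in> cell f" and u: "0 < u" "u \<le> 1"
  shows "(1 - u) *\<^sub>R x + u *\<^sub>R y \<in> cell f"
proof -
  obtain t a b c where f: "f = (t, a, b, c)" by (metis prod_cases4)
  have *: "w \<bullet> ((1 - u) *\<^sub>R x + u *\<^sub>R y) > 0" if "w \<bullet> x \<ge> 0" "w \<bullet> y > 0" for w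
    using that u by (simp add: inner_add_right add_nonneg_pos)
  show ?thesis
    using x y unfolding f cell_halfspaces closed_cell_halfspaces by (auto intro!: *)
qed

lemma convex_tri_eq: "convex {x \<in> closed_cell f. normal f \<bullet> x = 10}"
  using convex_Int[OF convex_closed_cell[of f] convex_hyperplane[of "normal f" 10]]
  by (simp add: Int_def)

lemma vertex_in_closed_cell: "l \<in> face f \<Longrightarrow> pos l \<in> closed_cell f \<and> normal f \<bullet> pos l = 10"
  by (cases f rule: prod_cases4) (auto simp: simps_by_index inner_axes split: if_splits)

lemma finite_face [simp]: "finite (face f)"
  by (cases f rule: prod_cases4) (auto simp: simps_by_index)

text \<open>The barycentric combination with its zero weights dropped. Proper subsets
  \<open>L\<close> are what the intersection of two triangles calls for.\<close>

lemma sum_hat_in_hull: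
  assumes "x \<in> closed_cell f" "normal f \<bullet> x = 10" "L \<subseteq> face f" and "\<And>l. l \<notin> L \<Longrightarrow> hat l x = 0"
  shows "x \<in> convex hull (pos ` L)"
proof -
  have "finite L" using finite_subset[OF assms(3) finite_face] .
  have "(\<Sum>l\<in>L. hat l x) = (\<Sum>l\<in>face f. hat l x)"
    "(\<Sum>l\<in>L. hat l x *\<^sub>R pos l) = (\<Sum>l\<in>face f. hat l x *\<^sub>R pos l)"
    using assms(3,4) by (auto intro!: sum.mono_neutral_left)
  then have "(\<Sum>l\<in>L. hat l x) = 1" and *: "(\<Sum>l\<in>L. hat l x *\<^sub>R pos l) = x"
    using hat_sum[OF assms(1,2)] by auto
  then have "(\<Sum>l\<in>L. hat l x *\<^sub>R pos l) \<in> convex hull (pos ` L)"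
    by (intro convex_sum \<open>finite L\<close> convex_convex_hull hat_nonneg) (auto intro: hull_inc)
  then show ?thesis using * by simp
qed

lemma tri_eq: "tri f = {x \<in> closed_cell f. normal f \<bullet> x = 10}"
proof
  show "tri f \<subseteq> {x \<in> closed_cell f. normal f \<bullet> x = 10}"
    unfolding tri_def using vertex_in_closed_cell
    by (intro hull_minimal convex_tri_eq) blast
  show "{x \<in> closed_cell f. normal f \<bullet> x = 10} \<subseteq> tri f"
    unfolding tri_def by (auto intro!: sum_hat_in_hull dest: hat_sum(3)[rotated 2])
qed

text \<open>The hats are functions on all of space, independent of a face. At a common point they
  vanish off \<open>face f\<close> and off \<open>face f'\<close>, so only common vertices carry
  weight.\<close>

lemma tri_Int: "tri f \<inter> tri f' = convex hull (pos ` face f \<inter> pos ` face f')"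
proof
  show "tri f \<inter> tri f' \<subseteq> convex hull (pos ` face f \<inter> pos ` face f')"
  proof
    fix x assume "x \<in> tri f \<inter> tri f'"
    then have "x \<in> convex hull (pos ` (face f \<inter> face f'))"
      by (intro sum_hat_in_hull[of x f]) (auto simp: tri_eq dest: hat_sum(3)[rotated 2])
    then show "x \<in> convex hull (pos ` face f \<inter> pos ` face f')"
      by (simp add: image_Int[OF inj_pos])
  qed
  show "convex hull (pos ` face f \<inter> pos ` face f') \<subseteq> tri f \<inter> tri f'"
    unfolding tri_def by (simp add: hull_mono)
qed

lemma ex_closed_cell: "\<exists>f. x \<in> closed_cell f"
  by (rule exI[of _ "(3 * \<bar>x $ i\<bar> \<ge> \<bar>x $ j\<bar>, x $ i \<ge> 0, x $ j \<ge> 0, x $ k \<ge> 0)"]) (auto simp: simps_by_index abs_if)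

text \<open>On the boundary, membership in a triangle thus depends on the cone alone.\<close>

lemma tri_iff: "x \<in> tri f \<longleftrightarrow> x \<in> closed_cell f \<and> gauge x = 10"
  using gauge_closed_cell[of x f] by (auto simp: tri_eq)

lemma gauge_eq_10: "{x. gauge x = 10} = (\<Union>f. tri f)"
  using ex_closed_cell by (auto simp: tri_iff)

section \<open>Topology and non-convexity of the solid\<close>

lemma continuous_gauge: "continuous_on UNIV gauge"
  unfolding gauge_def by (intro continuous_intros)

lemma gauge_scale: "0 \<le> c \<Longrightarrow> gauge (c *\<^sub>R x) = c * gauge x"
proof -
  assume c: "0 \<le> c"
  obtain f where x: "x \<in> closed_cell f" using ex_closed_cell by blast
  then have "c *\<^sub>R x \<in> closed_cell f"
    using c by (cases f rule: prod_cases4) (simp only: closed_cell_halfspaces; simp)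
  then show ?thesis using x by (simp add: gauge_closed_cell)
qed

lemma interior_solid: "interior solid = {x. gauge x < 10}"
  unfolding solid_def by (rule interior_homogeneous_sublevel[OF continuous_gauge gauge_scale]) auto

lemma closure_interior_solid: "closure (interior solid) = solid"
  unfolding interior_solid unfolding solid_def
  by (rule closure_homogeneous_sublevel[OF continuous_gauge gauge_scale]) auto

lemma closed_solid: "closed solid"
  by (metis closure_interior_solid closed_closure)

lemma frontier_solid: "frontier solid = {x. gauge x = 10}"
  unfolding frontier_def closure_closed[OF closed_solid] interior_solid by (auto simp: solid_def)

lemma compact_solid: "compact solid"
proof -
  have "norm x \<le> 25" if "x \<in> solid" for x
  proof -
    have "norm x \<le> \<bar>x $ i\<bar> + \<bar>x $ j\<bar> + \<bar>x $ k\<bar>"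
      using norm_le_l1_cart[of x] distinct_axes unfolding UNIV_axes by simp
    \<comment> \<open>The first branch of \<open>max\<close> already bounds the sum; 25 is a
      generous constant.\<close>
    also have "\<dots> \<le> 25"
      using that unfolding solid_def gauge_def mem_Collect_eq by linarith
    finally show ?thesis .
  qed
  then have "bounded solid" unfolding bounded_iff by blast
  then show ?thesis using closed_solid by (simp add: compact_eq_bounded_closed)
qed

lemma connected_solid: "connected solid"
proof (rule starlike_imp_connected)
  have "0 \<in> solid" using gauge_scale[of 0 0] by (simp add: solid_def)
  moreover have "closed_segment 0 x \<subseteq> solid" if "x \<in> solid" for x
  proof
    fix y assume "y \<in> closed_segment 0 x"
    then obtain u where u: "0 \<le> u" "u \<le> 1" "y = u *\<^sub>R x" by (auto simp: in_segment)
    have "u * gauge x \<le> u * 10" using u that by (intro mult_left_mono) (auto simp: solid_def)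
    then show "y \<in> solid" using u by (simp add: solid_def gauge_scale)
  qed
  ultimately show "starlike solid" unfolding starlike_def by blast
qed

lemma not_convex_solid: "\<not> convex solid"
proof
  assume c: "convex solid"
  have "pos (U True True) \<in> solid" "pos (U False True) \<in> solid"
    by (auto simp: solid_def gauge_def)
  \<comment> \<open>The midpoint is 6 on the \<open>j\<close> axis, beyond the reflex vertex at 5;
    its gauge is 12.\<close>
  then have "(1/2) *\<^sub>R pos (U True True) + (1/2) *\<^sub>R pos (U False True) \<in> solid"
    by (intro convexD[OF c]) auto
  then show False by (simp add: solid_def gauge_def)
qed

section \<open>The flat part of the boundary and the maximal faces\<close>

lemma inj_normal: "inj normal"
proof (rule injI)
  fix f f' assume "normal f = normal f'"
  then show "f = f'"
    by (cases f rule: prod_cases4; cases f' rule: prod_cases4)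
      (auto simp: simps_by_index point_eq_iff split: if_splits)
qed

text \<open>The vertices of a face are linearly independent, so the values of \<open>w\<close> there
  determine \<open>w\<close>, and the stated multiple of the normal has the value \<open>r\<close>
  at all three.\<close>

lemma plane_of_tri:
  assumes "\<And>v. v \<in> pos ` face f \<Longrightarrow> w \<bullet> v = r"
  shows "w = (r / 10) *\<^sub>R normal f"
proof -
  obtain t a b c where f: "f = (t, a, b, c)" by (metis prod_cases4)
  have "w \<bullet> pos (if t then X a else Y b) = r" "w \<bullet> pos (U a b) = r" "w \<bullet> pos (Z c) = r"
    by (intro assms imageI; simp add: f simps_by_index)+
  then show ?thesis
    unfolding f
    by (cases t; cases a; cases b; cases c) (simp_all add: simps_by_index inner_axes point_eq_iff)
qed

text \<open>A plane that fits the boundary near \<open>x\<close> contains every triangle through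
  \<open>x\<close>. Two triangles would give equal nonzero multiples of their normals, and distinct
  faces have distinct normals.\<close>

lemma flat_tri_unique:
  assumes "x \<in> flat_part solid" "x \<in> tri f" "x \<in> tri f'"
  shows "f = f'"
proof -
  obtain e w r where e: "0 < e" "w \<noteq> 0" "frontier solid \<inter> ball x e \<subseteq> {y. w \<bullet> y = r}"
    using assms(1) by (auto simp: flat_part_def is_plane_def)
  have *: "w = (r / 10) *\<^sub>R normal g" if "x \<in> tri g" for g
  proof (rule plane_of_tri, rule hull_subset_plane)
    show "x \<in> convex hull (pos ` face g)" using that by (simp add: tri_def)
    show "convex hull (pos ` face g) \<inter> ball x e \<subseteq> {y. w \<bullet> y = r}"
      using e(3) unfolding frontier_solid tri_def[symmetric] by (auto simp: tri_iff)
  qed (use e in auto)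
  have "(r / 10) *\<^sub>R normal f = (r / 10) *\<^sub>R normal f'" "r \<noteq> 0"
    using *[OF assms(2)] *[OF assms(3)] e(2) by auto
  then show ?thesis using inj_normal by (simp add: inj_eq)
qed

definition open_tri :: "bool \<times> bool \<times> bool \<times> bool \<Rightarrow> point set" where
  "open_tri f = {x \<in> cell f. normal f \<bullet> x = 10}"

lemma open_tri_subset_tri: "open_tri f \<subseteq> tri f"
  using cell_subset_closed_cell[of f] by (auto simp: open_tri_def tri_eq)

lemma open_tri_subset_flat: "open_tri f \<subseteq> flat_part solid"
proof
  fix x assume x: "x \<in> open_tri f"
  then obtain e where e: "0 < e" "ball x e \<subseteq> cell f"
    using open_cell[of f] by (auto simp: open_tri_def open_contains_ball)
  have "frontier solid \<inter> ball x e \<subseteq> {y. normal f \<bullet> y = 10}"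
    using e cell_subset_closed_cell[of f] gauge_closed_cell[of _ f] unfolding frontier_solid by fastforce
  moreover have "normal f \<noteq> 0" using x by (auto simp: open_tri_def)
  moreover have "x \<in> frontier solid"
    using x open_tri_subset_tri tri_iff unfolding frontier_solid by blast
  ultimately show "x \<in> flat_part solid"
    using e unfolding flat_part_def is_plane_def by blast
qed

text \<open>A defining inequality that is tight at \<open>x\<close> stays true when its sign is
  reversed; flipping the corresponding Boolean gives the other cone.\<close>

lemma closed_cell_boundary:
  assumes "x \<in> closed_cell f" "x \<notin> cell f"
  shows "\<exists>f'. f' \<noteq> f \<and> x \<in> closed_cell f'"
proof -
  obtain t a b c where f: "f = (t, a, b, c)" by (metis prod_cases4)
  have "x $ i = 0 \<or> x $ j = 0 \<or> x $ k = 0 \<or> 3 * (sg a * x $ i) = sg b * x $ j"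
    using assms unfolding f by (auto simp: simps_by_index split: if_splits)
  then have "x \<in> closed_cell (t, \<not> a, b, c) \<or> x \<in> closed_cell (t, a, \<not> b, c)
      \<or> x \<in> closed_cell (t, a, b, \<not> c) \<or> x \<in> closed_cell (\<not> t, a, b, c)"
    using assms unfolding f by (elim disjE) (auto simp: simps_by_index)
  then show ?thesis
    unfolding f by (elim disjE) (rule exI, rule conjI[rotated], assumption, simp)+
qed

text \<open>A point of the triangle outside the open cone lies in a second triangle as well, which
  \<open>flat_tri_unique\<close> forbids for flat points.\<close>

lemma flat_Int_tri: "flat_part solid \<inter> tri f = open_tri f"
proof
  show "flat_part solid \<inter> tri f \<subseteq> open_tri f"
  proof
    fix x assume x: "x \<in> flat_part solid \<inter> tri f"
    have "x \<in> cell f"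
    proof (rule ccontr)
      assume "x \<notin> cell f"
      then obtain f' where "f' \<noteq> f" "x \<in> tri f'"
        using closed_cell_boundary[of x f] x by (auto simp: tri_iff)
      then show False using x flat_tri_unique by blast
    qed
    then show "x \<in> open_tri f" using x by (simp add: open_tri_def tri_eq)
  qed
qed (use open_tri_subset_flat open_tri_subset_tri in blast)

text \<open>Shows that \<open>open_tri f\<close> is relatively open in the flat part, as the trace
  of an open cone.\<close>

lemma flat_Int_cell: "flat_part solid \<inter> cell f = open_tri f"
  using flat_Int_tri[of f] cell_subset_closed_cell[of f] frontier_solid
  by (auto simp: tri_eq flat_part_def open_tri_def gauge_closed_cell)

lemma flat_part_solid: "flat_part solid = (\<Union>f. open_tri f)"
proof -
  have "flat_part solid \<subseteq> (\<Union>f. tri f)"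
    using gauge_eq_10 frontier_solid by (auto simp: flat_part_def)
  then show ?thesis using flat_Int_tri by blast
qed

lemma ex_open_tri: "\<exists>x. x \<in> open_tri f"
proof -
  obtain t a b c where f: "f = (t, a, b, c)" by (metis prod_cases4)
  show ?thesis
    \<comment> \<open>The centroid of the triangle.\<close>
    by (rule exI[of _ "if t then vec3 (7/3 * sg a) (2 * sg b) (5/3 * sg c)
          else vec3 (2/3 * sg a) (11/3 * sg b) (5/3 * sg c)"])
      (auto simp: simps_by_index open_tri_def f inner_axes)
qed

lemma closure_open_tri: "closure (open_tri f) = tri f"
proof
  have "closed (tri f)"
    unfolding tri_def by (intro compact_imp_closed finite_imp_compact_convex_hull) auto
  then show "closure (open_tri f) \<subseteq> tri f"
    using open_tri_subset_tri by (rule closure_minimal[rotated])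
  show "tri f \<subseteq> closure (open_tri f)"
  proof
    fix x assume x: "x \<in> tri f"
    obtain y where y: "y \<in> open_tri f" using ex_open_tri by blast
    have *: "(1 - u) *\<^sub>R x + u *\<^sub>R y \<in> open_tri f" if "0 < u" "u \<le> 1" for u
      using cell_convex_combination[of x f y u] x y that
      by (simp add: open_tri_def tri_eq inner_add_right)
    \<comment> \<open>Points on the segment from \<open>y\<close> to \<open>x\<close>, starting at
      \<open>y\<close> and tending to \<open>x\<close>; all but the limit are guaranteed to lie in
      the open triangle.\<close>
    have "(\<lambda>n. (1 - 1 / real (Suc n)) *\<^sub>R x + (1 / real (Suc n)) *\<^sub>R y)
        \<longlonglongrightarrow> (1 - 0) *\<^sub>R x + 0 *\<^sub>R y"
      using LIMSEQ_inverse_real_of_nat by (intro tendsto_intros) (simp_all add: inverse_eq_divide)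
    moreover have "(1 - 1 / real (Suc n)) *\<^sub>R x + (1 / real (Suc n)) *\<^sub>R y \<in> open_tri f" for n
      by (intro *) auto
    ultimately show "x \<in> closure (open_tri f)"
      unfolding closure_sequential by (metis (no_types, lifting) add.right_neutral diff_zero scale_one scale_zero_left)
  qed
qed

lemma components_flat_part: "components (flat_part solid) = range open_tri"
proof (rule components_eqI)
  show "\<Union> (range open_tri) = flat_part solid" using flat_part_solid by simp
  show "openin (top_of_set (flat_part solid)) A" if "A \<in> range open_tri" for A
    using that flat_Int_cell open_cell openin_open_Int by (metis (no_types, lifting) imageE)
  show "connected A \<and> A \<noteq> {}" if A: "A \<in> range open_tri" for A
  proof -
    obtain f where f: "A = open_tri f" using A by auto
    have "convex (cell f \<inter> {x. normal f \<bullet> x = 10})"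
      by (intro convex_Int convex_cell convex_hyperplane)
    then have "convex A" by (simp add: f open_tri_def Int_def)
    then show ?thesis using ex_open_tri[of f] convex_connected f by auto
  qed
  show "pairwise disjnt (range open_tri)"
  proof (rule pairwiseI)
    fix A B assume "A \<in> range open_tri" "B \<in> range open_tri" "A \<noteq> B"
    then obtain f g where "A = open_tri f" "B = open_tri g" "f \<noteq> g" by blast
    then show "disjnt A B"
      using flat_tri_unique open_tri_subset_flat open_tri_subset_tri unfolding disjnt_iff by blast
  qed
qed

lemma faces_solid: "faces solid = range tri"
  by (simp add: faces_def components_flat_part image_image closure_open_tri)

section \<open>Outward normals and the two marker sets\<close>

lemma normal_inner_self: "normal f \<bullet> normal f = 9"
  by (cases f rule: prod_cases4) (auto simp: inner_axes simps_by_index)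

lemma normal_unit: "norm ((1/3) *\<^sub>R normal f) = 1"
  unfolding norm_eq_1 by (simp add: normal_inner_self)

lemma outward_normal_tri: "outward_normal solid (tri f) ((1/3) *\<^sub>R normal f)"
  unfolding outward_normal_def
proof (intro conjI ballI normal_unit)
  show "\<exists>c. tri f \<subseteq> {x. (1/3) *\<^sub>R normal f \<bullet> x = c}"
    by (rule exI[of _ "10/3"]) (auto simp: tri_eq)
  fix x assume "x \<in> tri f \<inter> flat_part solid"
  then have x: "x \<in> cell f" "normal f \<bullet> x = 10"
    using flat_Int_tri[of f] by (auto simp: open_tri_def)
  then obtain e where e: "0 < e" "ball x e \<subseteq> cell f"
    using open_cell[of f] by (auto simp: open_contains_ball)
  \<comment> \<open>Near \<open>x\<close> the gauge is linear with slope 9/3 along the unit normal,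
    so the sign of \<open>t\<close> decides between outside and inside.\<close>
  have gauge: "gauge (x + t *\<^sub>R (1/3) *\<^sub>R normal f) = 10 + 3 * t" if "\<bar>t\<bar> < e" for t
  proof -
    have "norm (t *\<^sub>R (1/3) *\<^sub>R normal f) < e"
      using normal_unit[of f] that by (metis mult.right_neutral norm_scaleR real_norm_def)
    then have "x + t *\<^sub>R (1/3) *\<^sub>R normal f \<in> cell f"
      using e by (auto simp: dist_norm)
    then show ?thesis
      using cell_subset_closed_cell[of f] gauge_closed_cell[of _ f] x
      by (auto simp: inner_add_right normal_inner_self)
  qed
  show "\<exists>e>0. \<forall>t. 0 < t \<and> t < e \<longrightarrow> x + t *\<^sub>R (1/3) *\<^sub>R normal f \<notin> solid
      \<and> x - t *\<^sub>R (1/3) *\<^sub>R normal f \<in> solid"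
    using e(1) gauge gauge[of "- t" for t] unfolding solid_def
    by (intro exI[of _ e]) auto
qed

lemma normal_nonzero: "normal f \<noteq> 0"
  using normal_unit[of f] by auto

text \<open>The octagon vertices on the \<open>i\<close> and \<open>j\<close> axes serve as marker
  points: exchanging the axes preserves this set of four, whereas the \<open>U\<close> vertices
  move.\<close>

fun apex :: "bool \<times> bool \<times> bool \<times> bool \<Rightarrow> label" where
  "apex (t, a, b, c) = (if t then X a else Y b)"

lemma apex_in_tri: "pos (apex f) \<in> tri f"
proof -
  have "apex f \<in> face f" by (cases f rule: prod_cases4) (simp add: simps_by_index)
  then show ?thesis by (simp add: tri_def hull_inc)
qed

definition normal_markers :: "(point \<times> point) set" where
  "normal_markers = range (\<lambda>f. (pos (apex f), (1/3) *\<^sub>R normal f))"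

text \<open>Derived from \<open>normal_markers\<close> so that invariance under the exchange carries
  over; 10/3 is the level 10 after normalising vectors of length 3.\<close>

definition plane_markers :: "(point \<times> point set) set" where
  "plane_markers = (\<lambda>(p, n). (p, {x. n \<bullet> x = 10/3})) ` normal_markers"

lemma normal_markers_markup: "point_normal_markup normal_markers solid"
  unfolding point_normal_markup_def faces_solid normal_markers_def
proof (intro conjI ballI)
  fix m assume "m \<in> range (\<lambda>f. (pos (apex f), (1/3) *\<^sub>R normal f))"
  then obtain f where m: "m = (pos (apex f), (1/3) *\<^sub>R normal f)" by blast
  show "case m of (p, n) \<Rightarrow> norm n = 1 \<and> (\<exists>F\<in>range tri. p \<in> F \<and> outward_normal solid F n)"
    unfolding m prod.case using apex_in_tri[of f] outward_normal_tri[of f] normal_unit[of f] by blast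
next
  fix F assume "F \<in> range tri"
  then obtain f where "F = tri f" by blast
  then show "\<exists>(p, n)\<in>range (\<lambda>f. (pos (apex f), (1/3) *\<^sub>R normal f)). p \<in> F \<and> outward_normal solid F n"
    using apex_in_tri[of f] outward_normal_tri[of f] by blast
qed simp

lemma plane_markers_markup: "point_plane_markup plane_markers solid"
proof -
  have M: "plane_markers = range (\<lambda>f. (pos (apex f), {x. (1/3) *\<^sub>R normal f \<bullet> x = 10/3}))"
    by (simp add: plane_markers_def normal_markers_def image_image)
  have "is_plane {x. (1/3) *\<^sub>R normal f \<bullet> x = 10/3}" for f
    unfolding is_plane_def using normal_nonzero[of f] by (metis scaleR_eq_0_iff zero_neq_one divide_eq_0_iff zero_neq_numeral)
  moreover have "tri f \<subseteq> {x. (1/3) *\<^sub>R normal f \<bullet> x = 10/3}" for f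
    by (auto simp: tri_eq)
  ultimately have *: "is_plane {x. (1/3) *\<^sub>R normal f \<bullet> x = 10/3}" "pos (apex f) \<in> {x. (1/3) *\<^sub>R normal f \<bullet> x = 10/3}"
    "pos (apex f) \<in> tri f" "plane_of_face (tri f) {x. (1/3) *\<^sub>R normal f \<bullet> x = 10/3}" for f
    unfolding plane_of_face_def using apex_in_tri by blast+
  show ?thesis
    unfolding point_plane_markup_def faces_solid M
  proof (intro conjI ballI)
    fix m assume "m \<in> range (\<lambda>f. (pos (apex f), {x. (1/3) *\<^sub>R normal f \<bullet> x = 10/3}))"
    then obtain f where m: "m = (pos (apex f), {x. (1/3) *\<^sub>R normal f \<bullet> x = 10/3})" by blast
    show "case m of (p, R) \<Rightarrow> is_plane R \<and> p \<in> R \<and> (\<exists>F\<in>range tri. p \<in> F \<and> plane_of_face F R)"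
      unfolding m prod.case using *[of f] by blast
  next
    fix F assume "F \<in> range tri"
    then obtain f where "F = tri f" by blast
    then show "\<exists>(p, R)\<in>range (\<lambda>f. (pos (apex f), {x. (1/3) *\<^sub>R normal f \<bullet> x = 10/3})).
        p \<in> F \<and> plane_of_face F R"
      using *[of f] by blast
  qed simp
qed

section \<open>The combinatorial triangulation\<close>

definition triangulation :: "point set set" where
  "triangulation = range (\<lambda>f. pos ` face f)"

lemma inj_face: "inj face"
proof (rule injI)
  fix f f' assume eq: "face f = face f'"
  obtain t a b c where f: "f = (t, a, b, c)" by (metis prod_cases4)
  have "(if t then X a else Y b) \<in> face f'" "U a b \<in> face f'" "Z c \<in> face f'"
    unfolding eq[symmetric] by (simp_all add: f simps_by_index)
  then show "f = f'"
    unfolding f by (cases f' rule: prod_cases4) (auto simp: simps_by_index split: if_splits)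
qed

lemma inj_face_image: "inj (\<lambda>f. pos ` face f)"
  using inj_face inj_image_eq_iff[OF inj_pos] by (simp add: inj_def)

lemma card_face: "card (face f) = 3"
  by (cases f rule: prod_cases4) (auto simp: simps_by_index)

lemma not_collinear_face: "\<not> collinear (pos ` face f)"
proof
  assume "collinear (pos ` face f)"
  then obtain d where d: "\<And>x y. x \<in> pos ` face f \<Longrightarrow> y \<in> pos ` face f \<Longrightarrow> \<exists>c. x - y = c *\<^sub>R d"
    unfolding collinear_def by blast
  obtain t a b c where f: "f = (t, a, b, c)" by (metis prod_cases4)
  obtain r where "pos (apex f) - pos (Z c) = r *\<^sub>R d"
    using d[of "pos (apex f)" "pos (Z c)"] by (auto simp: f simps_by_index)
  moreover obtain q where "pos (U a b) - pos (Z c) = q *\<^sub>R d"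
    using d[of "pos (U a b)" "pos (Z c)"] by (auto simp: f simps_by_index)
  \<comment> \<open>One of the first two coordinates vanishes in the first difference but not in the
    second. This forces \<open>r = 0\<close>, although the first difference is nonzero.\<close>
  ultimately show False
    unfolding f by (cases t; cases a; cases b; cases c) (auto simp: point_eq_iff)
qed

text \<open>The face across the edge opposite to the given vertex.\<close>

fun neighbour :: "bool \<times> bool \<times> bool \<times> bool \<Rightarrow> label \<Rightarrow> bool \<times> bool \<times> bool \<times> bool" where
  "neighbour (t, a, b, c) (Z s) = (t, a, b, \<not> c)"
| "neighbour (t, a, b, c) (U s s') = (if t then (t, a, \<not> b, c) else (t, \<not> a, b, c))"
| "neighbour (t, a, b, c) _ = (\<not> t, a, b, c)"

lemma neighbour_unique:
  assumes "l \<in> face f"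
  shows "f' \<noteq> f \<and> face f - {l} \<subseteq> face f' \<longleftrightarrow> f' = neighbour f l"
  using assms
  by (cases f rule: prod_cases4; cases f' rule: prod_cases4; cases l)
    (auto simp: simps_by_index split: if_splits)

text \<open>An edge is a face with one label removed, so \<open>neighbour_unique\<close> names the
  only other face; the rest transports this along the injective \<open>pos\<close>.\<close>

lemma edge_unique:
  assumes "V \<in> triangulation" "e \<subseteq> V" "card e = 2"
  shows "card {W \<in> triangulation. W \<noteq> V \<and> e \<subseteq> W} = 1"
proof -
  obtain f where V: "V = pos ` face f" using assms(1) by (auto simp: triangulation_def)
  obtain E where E: "E \<subseteq> face f" "e = pos ` E" using assms(2) unfolding V by (meson subset_imageE)
  have "card E = 2" using assms(3) unfolding E by (simp add: card_image inj_on_subset[OF inj_pos])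
  then have "card (face f - E) = 1"
    using card_face by (simp add: card_Diff_subset[OF finite_subset[OF E(1) finite_face] E(1)])
  then obtain l where "face f - E = {l}" using card_1_singletonE by blast
  then have l: "l \<in> face f" "E = face f - {l}" using E(1) by auto
  have "{f'. f' \<noteq> f \<and> face f - {l} \<subseteq> face f'} = {neighbour f l}"
    using neighbour_unique[OF l(1)] by blast
  moreover have "{W \<in> triangulation. W \<noteq> V \<and> e \<subseteq> W} =
      (\<lambda>f'. pos ` face f') ` {f'. f' \<noteq> f \<and> face f - {l} \<subseteq> face f'}" (is "?L = ?R")
  proof
    show "?L \<subseteq> ?R"
    proof
      fix W assume W: "W \<in> ?L"
      then obtain f' where f': "W = pos ` face f'" unfolding triangulation_def by blast
      then have "f' \<noteq> f" "face f - {l} \<subseteq> face f'"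
        using W inj_image_subset_iff[OF inj_pos] unfolding V E(2) l(2) by blast+
      then show "W \<in> ?R" using f' by blast
    qed
    show "?R \<subseteq> ?L"
    proof
      fix W assume "W \<in> ?R"
      then obtain f' where f': "W = pos ` face f'" "f' \<noteq> f" "face f - {l} \<subseteq> face f'" by blast
      then have "W \<noteq> V" "e \<subseteq> W"
        using injD[OF inj_face_image, of f' f] inj_image_subset_iff[OF inj_pos]
        unfolding V E(2) l(2) by blast+
      then show "W \<in> ?L" using f'(1) unfolding triangulation_def by blast
    qed
  qed
  ultimately have "{W \<in> triangulation. W \<noteq> V \<and> e \<subseteq> W} = {pos ` face (neighbour f l)}" by simp
  then show ?thesis by simp
qed

text \<open>The order is cyclic: each step, including the one from last to first, flips one Boolean
  and crosses an edge at the vertex.\<close>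

fun link :: "label \<Rightarrow> (bool \<times> bool \<times> bool \<times> bool) list" where
  "link (X s) = [(True, s, True, True), (True, s, True, False), (True, s, False, False), (True, s, False, True)]"
| "link (Y s) = [(False, True, s, True), (False, True, s, False), (False, False, s, False), (False, False, s, True)]"
| "link (U s s') = [(True, s, s', True), (True, s, s', False), (False, s, s', False), (False, s, s', True)]"
| "link (Z s) = [(True, True, True, s), (False, True, True, s), (False, False, True, s), (True, False, True, s),
     (True, False, False, s), (False, False, False, s), (False, True, False, s), (True, True, False, s)]"

lemma distinct_link: "distinct (link l)"
  by (cases l) auto

lemma set_link: "set (link l) = {f. l \<in> face f}"
proof (rule set_eqI)
  fix f :: "bool \<times> bool \<times> bool \<times> bool"
  obtain t a b c where f: "f = (t, a, b, c)" by (metis prod_cases4)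
  show "f \<in> set (link l) \<longleftrightarrow> f \<in> {f. l \<in> face f}"
    unfolding f by (cases l; cases t; cases a; cases b; cases c) (simp_all add: simps_by_index)
qed

lemma link_adjacent:
  assumes "n < length (link l)"
  shows "card (face (link l ! n) \<inter> face (link l ! ((n + 1) mod length (link l)))) = 2"
proof (cases "\<exists>s. l = Z s")
  case True
  then obtain s where l: "l = Z s" by blast
  have len: "length (link (Z s)) = 8" by simp
  have "n \<in> {0, 1, 2, 3, 4, 5, 6, 7}" using assms unfolding l len by auto
  then show ?thesis
    unfolding l len by (elim insertE emptyE) (simp_all add: simps_by_index)
next
  case False
  then have len: "length (link l) = 4" by (cases l) simp_all
  have "n \<in> {0, 1, 2, 3}" using assms unfolding len by auto
  then show ?thesis
    unfolding len using False by (elim insertE emptyE; cases l) (simp_all add: simps_by_index)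
qed

lemma triangulated_solid: "triangulated_boundary solid triangulation"
  unfolding triangulated_boundary_def
proof (intro conjI ballI allI impI)
  show "finite triangulation" by (simp add: triangulation_def)
  show "frontier solid = \<Union> ((\<lambda>V. convex hull V) ` triangulation)"
    by (simp add: frontier_solid gauge_eq_10 triangulation_def tri_def image_image)
next
  fix V assume "V \<in> triangulation"
  then obtain f where V: "V = pos ` face f" by (auto simp: triangulation_def)
  show "card V = 3" by (simp add: V card_image inj_on_subset[OF inj_pos] card_face)
  show "\<not> collinear V" using not_collinear_face V by simp
next
  fix V W assume "V \<in> triangulation" "W \<in> triangulation"
  then show "convex hull V \<inter> convex hull W = convex hull (V \<inter> W)"
    unfolding triangulation_def using tri_Int[unfolded tri_def] by blast
next
  fix V e assume "V \<in> triangulation" "e \<subseteq> V \<and> card e = 2"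
  then show "card {W \<in> triangulation. W \<noteq> V \<and> e \<subseteq> W} = 1" using edge_unique by blast
next
  fix v assume "v \<in> \<Union> triangulation"
  then obtain l where v: "v = pos l" by (auto simp: triangulation_def)
  let ?xs = "map (\<lambda>f. pos ` face f) (link l)"
  have "distinct ?xs"
    by (simp add: distinct_map distinct_link inj_on_subset[OF inj_face_image])
  moreover have "set ?xs = {V \<in> triangulation. v \<in> V}"
    using inj_image_mem_iff[OF inj_pos]
    unfolding set_map set_link triangulation_def v by blast
  moreover have "card (?xs ! n \<inter> ?xs ! ((n + 1) mod length ?xs)) = 2" if "n < length ?xs" for n
  proof -
    \<comment> \<open>The wrapped index must be in range before \<open>map\<close> can be evaluated
      there.\<close>
    have "(n + 1) mod length (link l) < length (link l)" using that by (intro mod_less_divisor) auto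
    then have "?xs ! n \<inter> ?xs ! ((n + 1) mod length ?xs)
        = pos ` (face (link l ! n) \<inter> face (link l ! ((n + 1) mod length (link l))))"
      using that by (simp add: image_Int[OF inj_pos])
    then show ?thesis
      using link_adjacent that by (simp add: card_image inj_on_subset[OF inj_pos])
  qed
  ultimately show "\<exists>xs. distinct xs \<and> set xs = {V \<in> triangulation. v \<in> V} \<and>
      (\<forall>i<length xs. card (xs ! i \<inter> xs ! ((i + 1) mod length xs)) = 2)"
    by blast
qed

lemma polyhedron_solid: "polyhedron solid"
  unfolding polyhedron_def
  using compact_solid connected_solid closure_interior_solid triangulated_solid by blast

end

section \<open>Exchanging the two axes, and the conclusion\<close>

lemma (in axes) axes_swap: "axes j i k"
  using distinct_axes by unfold_locales auto

lemma (in axes) vec3_swap: "axes.vec3 j i p q r = vec3 q p r"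
proof -
  interpret swap: axes j i k by (rule axes_swap)
  show ?thesis by (simp add: point_eq_iff)
qed

lemma (in axes) normal_markers_swap_subset: "normal_markers \<subseteq> axes.normal_markers j i"
proof -
  interpret swap: axes j i k by (rule axes_swap)
  let ?m = "\<lambda>f. (swap.pos (swap.apex f), (1/3) *\<^sub>R swap.normal f)"
  \<comment> \<open>An \<open>X\<close> vertex is a \<open>Y\<close> vertex of the mirror image. The
    signs \<open>\<not> b\<close> and \<open>\<not> a\<close> compensate the minus sign in the first
    coordinate of the \<open>Y\<close> normals.\<close>
  have "(pos (apex (True, a, b, c)), (1/3) *\<^sub>R normal (True, a, b, c)) = ?m (False, \<not> b, a, c)"
    "(pos (apex (False, a, b, c)), (1/3) *\<^sub>R normal (False, a, b, c)) = ?m (True, b, \<not> a, c)" for a b c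
    by (simp_all add: vec3_swap simps_by_index swap.simps_by_index)
  note * = range_eqI[where f = ?m, OF this(1)] range_eqI[where f = ?m, OF this(2)]
  have "(pos (apex f), (1/3) *\<^sub>R normal f) \<in> swap.normal_markers" for f
  proof -
    obtain t a b c where f: "f = (t, a, b, c)" by (metis prod_cases4)
    show ?thesis unfolding swap.normal_markers_def f using * by (cases t) simp_all
  qed
  then show ?thesis unfolding normal_markers_def by blast
qed

lemma (in axes) normal_markers_swap: "axes.normal_markers j i = normal_markers"
proof -
  interpret swap: axes j i k by (rule axes_swap)
  show ?thesis
    using normal_markers_swap_subset swap.normal_markers_swap_subset by blast
qed

theorem mainTheorem3:
  shows "\<exists>P Q. polyhedron P \<and> polyhedron Q \<and> \<not> convex P \<and> \<not> convex Q \<and> P \<noteq> Q \<and>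
     (\<exists>M. point_plane_markup M P \<and> point_plane_markup M Q) \<and>
     (\<exists>N. point_normal_markup N P \<and> point_normal_markup N Q)"
proof -
  interpret P: axes 1 2 3 by unfold_locales auto
  interpret Q: axes 2 1 3 by (rule P.axes_swap)
  \<comment> \<open>A \<open>U\<close> vertex of the first solid; its gauge in the second is
    14.\<close>
  have "P.vec3 2 6 0 \<in> P.solid" "P.vec3 2 6 0 \<notin> Q.solid"
    using P.vec3_nth[of 2 6 0]
    by (simp_all add: P.solid_def Q.solid_def P.gauge_def Q.gauge_def)
  then have "P.solid \<noteq> Q.solid" by blast
  moreover have "point_normal_markup P.normal_markers Q.solid"
    using Q.normal_markers_markup P.normal_markers_swap by simp
  moreover have "point_plane_markup P.plane_markers Q.solid"
    using Q.plane_markers_markup P.normal_markers_swap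
    by (simp add: P.plane_markers_def Q.plane_markers_def)
  ultimately show ?thesis
    using P.polyhedron_solid Q.polyhedron_solid P.not_convex_solid Q.not_convex_solid
      P.normal_markers_markup P.plane_markers_markup by blast
qed

end
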